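(* For every integer $n\ge 0$ with $n\neq 2$ and every integer $m$, the number of partitions $\vec{\pi}$ of $n$ without repeated odd parts with $\operatorname{M2crank}(\vec{\pi})=m$ equals $M2(m,n)$, where for $n\ne 2$ the integer $M2(m,n)$ is the coefficient of $z^mq^n$ in $$\frac{(-q;q^2)_\infty(q^2;q^2)_\infty}{(zq^2;q^2)_\infty(z^{-1}q^2;q^2)_\infty}.$$
   Context: Notation: $(a;q)_\infty=\prod_{k=0}^\infty(1-aq^k)$; the generating function is expanded as a formal power series in $q$ whose coefficients are Laurent polynomials in $z$. A partition of $n$ without repeated odd parts is identified with a pair $\vec{\pi}=(\pi_1,\pi_2)\in\mathcal{POD}\times\mathcal{PE}$ with $|\pi_1|+|\pi_2|=n$, where $\mathcal{POD}$ is the set of partitions into distinct odd parts, $\mathcal{PE}$ is the set of partitions into even parts (both including the empty partition $\varnothing$), $|\pi|$ is the sum of the parts of $\pi$, $\pi_1$ consists of the odd parts and $\pi_2$ of the even parts. For a non-empty partition $\pi$, let $\ell(\pi)$ be its largest part, $\omega(\pi)$ the number of ones in $\pi$, and $\mu(\pi)$ the number of parts of $\pi$ larger than $\omega(\pi)$. The crank is $$\operatorname{crank}(\pi)=\begin{cases}\ell(\pi)&\text{if }\omega(\pi)=0,\\ \mu(\pi)-\omega(\pi)&\text{otherwise.}\end{cases}$$ For $\pi\in\mathcal{PE}$, $\frac{\pi}{2}$ denotes the partition obtained by dividing each part of $\pi$ by $2$. For $\pi\in\mathcal{POD}$ define $\theta(\pi)$ as follows. If $\ell(\pi)\ge 5$,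 then $\theta(\pi)=0$ if $\ell(\pi)-2$ is a part of $\pi$, and $\theta(\pi)=1$ otherwise. If $\ell(\pi)\in\{1,3\}$, then $\theta(\pi)=0$ if $1$ is a part of $\pi$, and $\theta(\pi)=1$ otherwise. Also $\theta(\varnothing)=0$. For $\vec\pi=(\pi_1,\pi_2)\in\mathcal{POD}\times\mathcal{PE}$ define $$\operatorname{M2crank}(\vec{\pi})=\begin{cases}\operatorname{crank}\bigl(\frac{\pi_2}{2}\bigr)&\text{if }\pi_2\ne\varnothing,\\ \theta(\pi_1)&\text{if }\pi_2=\varnothing.\end{cases}$$ *)

theory Defs
  imports
    "HOL-Library.Multiset"
    "HOL-Library.Poly_Mapping"
    "HOL-Computational_Algebra.Formal_Power_Series"
    "HOL-Analysis.Infinite_Products"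
begin

section \<open>Partitions without repeated odd parts\<close>

text \<open>
  A partition is the multiset of its (positive) parts; \<open>{#}\<close> is the empty partition, and
  the sum of the parts of \<open>\<pi>\<close> is \<^term>\<open>sum_mset \<pi>\<close>.
\<close>

definition POD :: "nat multiset set" where
  "POD = {\<pi>. (\<forall>k \<in># \<pi>. odd k) \<and> (\<forall>k. count \<pi> k \<le> 1)}"

definition PE :: "nat multiset set" where
  "PE = {\<pi>. \<forall>k \<in># \<pi>. even k \<and> 0 < k}"

text \<open>
  The largest part and the crank are meaningful only for a non-empty partition; they are used
  below only in that case.
\<close>

definition largest_part :: "nat multiset \<Rightarrow> nat" where
  "largest_part \<pi> = Max_mset \<pi>"

definition num_ones :: "nat multiset \<Rightarrow> nat" where
  "num_ones \<pi> = count \<pi> 1"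

definition num_parts_gt_ones :: "nat multiset \<Rightarrow> nat" where
  "num_parts_gt_ones \<pi> = size {#k \<in># \<pi>. num_ones \<pi> < k#}"

definition crank :: "nat multiset \<Rightarrow> int" where
  "crank \<pi> = (if num_ones \<pi> = 0 then int (largest_part \<pi>)
              else int (num_parts_gt_ones \<pi>) - int (num_ones \<pi>))"

definition half_partition :: "nat multiset \<Rightarrow> nat multiset" where
  "half_partition \<pi> = image_mset (\<lambda>k. k div 2) \<pi>"

text \<open>On \<^const>\<open>POD\<close>, the last branch is the case of largest part 1 or 3.\<close>

definition theta :: "nat multiset \<Rightarrow> int" where
  "theta \<pi> =
     (if \<pi> = {#} then 0
      else if 5 \<le> largest_part \<pi> then (if largest_part \<pi> - 2 \<in># \<pi> then 0 else 1)
      else (if 1 \<in># \<pi> then 0 else 1))"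

fun M2crank :: "nat multiset \<times> nat multiset \<Rightarrow> int" where
  "M2crank (\<pi>1, \<pi>2) = (if \<pi>2 \<noteq> {#} then crank (half_partition \<pi>2) else theta \<pi>1)"

text \<open>A partition of \<open>n\<close> without repeated odd parts, as the pair (odd parts, even parts).\<close>

definition parts_no_rep_odd :: "nat \<Rightarrow> (nat multiset \<times> nat multiset) set" where
  "parts_no_rep_odd n = {(\<pi>1, \<pi>2) \<in> POD \<times> PE. sum_mset \<pi>1 + sum_mset \<pi>2 = n}"


section \<open>The generating function\<close>

text \<open>
  Laurent polynomials over the integers in \<open>z\<close> are finitely supported functions from exponents
  to coefficients, with convolution as multiplication; the generating function is a formal power
  series in \<open>q\<close> over this ring.
\<close>

type_synonym laurent = "int \<Rightarrow>\<^sub>0 int"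

abbreviation q_var :: "laurent fps" where
  "q_var \<equiv> fps_X"

abbreviation z_var :: "laurent fps" where
  "z_var \<equiv> fps_const (Poly_Mapping.single 1 1)"

abbreviation z_inv :: "laurent fps" where
  "z_inv \<equiv> fps_const (Poly_Mapping.single (- 1) 1)"

lemma z_mult_z_inv: "z_var * z_inv = 1"
  by (simp add: Poly_Mapping.mult_single)

text \<open>\<open>(a; b)\<^sub>\<infinity>\<close>, the infinite product being taken in the usual (adic) topology on power series.\<close>

definition qpoch_inf :: "'a::comm_ring_1 fps \<Rightarrow> 'a fps \<Rightarrow> 'a fps" where
  "qpoch_inf a b = prodinf (\<lambda>k. 1 - a * b ^ k)"

lemma has_prod_qpoch_inf:
  fixes a b :: "'a::comm_ring_1 fps"
  assumes a: "fps_nth a 0 = 0" and b: "fps_nth b 0 = 0"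
  shows "(\<lambda>k. 1 - a * b ^ k) has_prod qpoch_inf a b"
    and "fps_nth (qpoch_inf a b) 0 = 1"
proof -
  define P where "P n = (\<Prod>k\<le>n. 1 - a * b ^ k)" for n
  define L where "L = Abs_fps (\<lambda>N. fps_nth (P N) N)"
  have pw: "fps_nth (b ^ k) i = 0" if "i < k" for i k
    using that b by (rule startsby_zero_power_prefix[rule_format, rotated])
  have step: "fps_nth (P (Suc n)) N = fps_nth (P n) N" if "N \<le> n" for n N
  proof -
    have "P (Suc n) = P n - (P n * a) * b ^ Suc n"
      by (simp add: P_def algebra_simps)
    moreover have "fps_nth ((P n * a) * b ^ Suc n) N = 0"
      unfolding fps_mult_nth using that by (intro sum.neutral ballI) (simp add: pw del: power_Suc)
    ultimately show ?thesis by simp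
  qed
  have stable: "fps_nth (P n) N = fps_nth L N" if "N \<le> n" for n N
    using that by (induction rule: dec_induct) (simp_all add: L_def step)
  have lim: "P \<longlonglongrightarrow> L"
    by (intro tendsto_fpsI eventually_sequentiallyI) (rule stable)
  have L0: "fps_nth L 0 = 1"
    using a by (simp add: L_def P_def)
  then have "L \<noteq> 0" by auto
  with lim have hp: "(\<lambda>k. 1 - a * b ^ k) has_prod L"
    by (simp add: has_prod_def raw_has_prod_def P_def[abs_def])
  have nz: "1 - a * b ^ k \<noteq> 0" for k
  proof
    assume "1 - a * b ^ k = 0"
    then have "fps_nth (1 - a * b ^ k) 0 = 0" by simp
    with a show False by simp
  qed
  have "L' = L" if "(\<lambda>k. 1 - a * b ^ k) has_prod L'" for L'
    using that nz lim LIMSEQ_unique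
    unfolding has_prod_def raw_has_prod_def P_def[abs_def] by auto
  with hp have "qpoch_inf a b = L"
    unfolding qpoch_inf_def prodinf_def by (rule the_equality)
  with hp L0 show "(\<lambda>k. 1 - a * b ^ k) has_prod qpoch_inf a b"
    and "fps_nth (qpoch_inf a b) 0 = 1" by simp_all
qed

definition M2_denom :: "laurent fps" where
  "M2_denom = qpoch_inf (z_var * q_var ^ 2) (q_var ^ 2) * qpoch_inf (z_inv * q_var ^ 2) (q_var ^ 2)"

text \<open>
  The Laurent polynomials are not a field, so the quotient is written with the
  inverse of a power series that has constant coefficient 1.
\<close>

definition M2_gf :: "laurent fps" where
  "M2_gf = qpoch_inf (- q_var) (q_var ^ 2) * qpoch_inf (q_var ^ 2) (q_var ^ 2) * fps_right_inverse M2_denom 1"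

lemma M2_gf_mult_denom:
  "M2_gf * M2_denom = qpoch_inf (- q_var) (q_var ^ 2) * qpoch_inf (q_var ^ 2) (q_var ^ 2)"
proof -
  have "fps_nth M2_denom 0 = 1"
    by (simp add: M2_denom_def has_prod_qpoch_inf(2))
  then have "M2_denom * fps_right_inverse M2_denom 1 = 1"
    by (intro fps_right_inverse) simp
  then show ?thesis
    by (simp add: M2_gf_def mult.assoc mult.commute[of _ M2_denom])
qed

text \<open>The coefficient of \<open>z\<^sup>m q\<^sup>n\<close>, meant as the number \<open>M2(m, n)\<close> for \<open>n \<noteq> 2\<close> only.\<close>

definition M2 :: "int \<Rightarrow> nat \<Rightarrow> int" where
  "M2 m n = Poly_Mapping.lookup (fps_nth M2_gf n) m"

end

(*
  Multiplying the crank generating function of non-empty partitions by (zq;q)_inf and sorting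
  partitions by their largest part (if there are no ones) or by the number of ones turns it into
  two series summed by the q-binomial theorem: Euler's sum for 1/(zq;q)_inf and
  sum_n (zq;q)_n/(q;q)_n (q/z)^n = (q^2;q)_inf/(q/z;q)_inf.  This is the Andrews-Garvan identity
    1 + (z - 1) q + sum_{pi nonempty} z^crank(pi) q^|pi| = (q;q)_inf / ((zq;q)_inf (q/z;q)_inf).
  Replace q by q^2 and multiply by (-q;q^2)_inf.  The anomalous part (-q;q^2)_inf (1 + (z - 1) q^2)
  is what theta accounts for when n is not 2: theta(pi) = 1 exactly when pi arises from a
  non-empty partition of n - 2 into distinct odd parts by adding 2 to the largest part.
*)
theory Submission
  imports Defs
begin

section \<open>Power series and the $q$-binomial theorem\<close>

instance fps :: (ab_group_add) topological_ab_group_add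
proof
  fix a b :: "'a fps"
  show "LIM x (nhds a \<times>\<^sub>F nhds b). fst x + snd x :> nhds (a + b)"
  proof (rule tendsto_fpsI)
    fix n
    have "eventually (\<lambda>f. fps_nth f n = fps_nth c n) (nhds c)" for c :: "'a fps"
      using filterlim_ident[of "nhds c"] unfolding tendsto_fps_iff by blast
    from eventually_prodI[OF this[of a] this[of b]]
    show "\<forall>\<^sub>F x in nhds a \<times>\<^sub>F nhds b. fps_nth (fst x + snd x) n = fps_nth (a + b) n"
      by eventually_elim simp
  qed
  show "(uminus \<longlongrightarrow> - a) (nhds a)"
    using filterlim_ident[of "nhds a"] unfolding tendsto_fps_iff by (auto elim: eventually_mono)
qed

text \<open>The coefficient of index \<open>n\<close> of a product depends only on the coefficients
  of index at most \<open>n\<close> of the factors, and these are eventually constant.\<close>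

instance fps :: (ring) topological_semigroup_mult
proof
  fix a b :: "'a fps"
  show "LIM x (nhds a \<times>\<^sub>F nhds b). fst x * snd x :> nhds (a * b)"
  proof (rule tendsto_fpsI)
    fix n
    have ev: "eventually (\<lambda>f. \<forall>i\<in>{..n}. fps_nth f i = fps_nth c i) (nhds c)" for c :: "'a fps"
      using filterlim_ident[of "nhds c"] unfolding tendsto_fps_iff
      by (simp add: eventually_ball_finite_distrib)
    from eventually_prodI[OF ev[of a] ev[of b]]
    show "\<forall>\<^sub>F x in nhds a \<times>\<^sub>F nhds b. fps_nth (fst x * snd x) n = fps_nth (a * b) n"
      by eventually_elim (simp add: fps_mult_nth)
  qed
qed

lemma fps_nth_const_X_power_mult:
  "fps_nth (fps_const c * fps_X ^ l * f) n = (if n < l then 0 else c * fps_nth f (n - l))"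
  by (simp add: mult.assoc fps_X_power_mult_nth)

lemma fps_sums_mult_right:
  fixes c :: "nat \<Rightarrow> 'a::ring fps"
  assumes "c sums S"
  shows "(\<lambda>n. c n * g) sums (S * g)"
  using tendsto_mult[OF assms[unfolded sums_def] tendsto_const[of g]]
  by (simp add: sums_def sum_distrib_right)

text \<open>The \<open>n\<close>-th summand has order at least \<open>n\<close>, so the coefficient
  of index \<open>N\<close> of a partial sum no longer changes once the summand \<open>N\<close> is
  included.\<close>

lemma fps_sumsI:
  fixes c :: "nat \<Rightarrow> 'a::ab_group_add fps"
  assumes "\<And>n i. i < n \<Longrightarrow> fps_nth (c n) i = 0"
    and "\<And>N. fps_nth S N = (\<Sum>n\<le>N. fps_nth (c n) N)"
  shows "c sums S"
  unfolding sums_def_le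
proof (intro tendsto_fpsI eventually_sequentiallyI)
  fix N m :: nat assume "N \<le> m"
  then show "fps_nth (\<Sum>n\<le>m. c n) N = fps_nth S N"
    unfolding fps_sum_nth assms(2) by (intro sum.mono_neutral_right) (auto simp: assms(1))
qed

section \<open>Infinite products as limits, and the splitting off of factors\<close>

text \<open>\<open>has_prod\<close> treats vanishing factors separately. Every factor here has
  constant coefficient 1, so none vanishes and the partial products themselves converge.\<close>

lemma qpoch_inf_LIMSEQ:
  fixes a b :: "'a::comm_ring_1 fps"
  assumes a: "fps_nth a 0 = 0" and b: "fps_nth b 0 = 0"
  shows "(\<lambda>n. \<Prod>k<n. 1 - a * b ^ k) \<longlonglongrightarrow> qpoch_inf a b"
proof -
  have nz: "1 - a * b ^ k \<noteq> 0" for k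
  proof
    assume "1 - a * b ^ k = 0"
    then have "fps_nth (1 - a * b ^ k) 0 = 0" by simp
    with a show False by simp
  qed
  with has_prod_qpoch_inf(1)[OF assms] show ?thesis
    unfolding has_prod_def raw_has_prod_def by (auto simp: LIMSEQ_lessThan_iff_atMost)
qed

lemma qpoch_inf_rec:
  fixes a b :: "'a::comm_ring_1 fps"
  assumes a: "fps_nth a 0 = 0" and b: "fps_nth b 0 = 0"
  shows "qpoch_inf a b = (1 - a) * qpoch_inf (a * b) b"
proof (rule LIMSEQ_unique)
  show "(\<lambda>n. \<Prod>k<Suc n. 1 - a * b ^ k) \<longlonglongrightarrow> qpoch_inf a b"
    using LIMSEQ_Suc[OF qpoch_inf_LIMSEQ[OF assms]] .
  have "(\<lambda>n. (1 - a) * (\<Prod>k<n. 1 - (a * b) * b ^ k)) \<longlonglongrightarrow> (1 - a) * qpoch_inf (a * b) b"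
    by (intro tendsto_mult tendsto_const qpoch_inf_LIMSEQ) (simp_all add: a b)
  then show "(\<lambda>n. \<Prod>k<Suc n. 1 - a * b ^ k) \<longlonglongrightarrow> (1 - a) * qpoch_inf (a * b) b"
    by (simp add: prod.lessThan_Suc_shift mult.assoc del: prod.lessThan_Suc)
qed

lemma qpoch_inf_split:
  fixes a b :: "'a::comm_ring_1 fps"
  assumes "fps_nth a 0 = 0" "fps_nth b 0 = 0"
  shows "qpoch_inf a b = (\<Prod>k<n. 1 - a * b ^ k) * qpoch_inf (a * b ^ n) b"
proof (induction n)
  case (Suc n)
  then show ?case
    using qpoch_inf_rec[of "a * b ^ n" b] assms by (simp add: mult_ac)
qed simp

lemma qpoch_inf_zero:
  fixes b :: "'a::comm_ring_1 fps"
  assumes "fps_nth b 0 = 0"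
  shows "qpoch_inf 0 b = 1"
proof -
  have "(\<lambda>n. \<Prod>k<n. 1 - 0 * b ^ k) \<longlonglongrightarrow> 1"
    by simp
  with qpoch_inf_LIMSEQ[of 0 b] assms show ?thesis
    by (metis LIMSEQ_unique fps_zero_nth)
qed

section \<open>The q-binomial theorem\<close>

text \<open>The recurrence is that of (a;b)_n/(b;b)_n, written without division. The identity
  truncates (1 - t) F(t) = (1 - a t) F(t b), with boundary term
  \<open>c M * (1 - b ^ M) * t ^ M\<close>.\<close>

lemma q_binomial_partial_sum:
  fixes a t b :: "'a::comm_ring_1"
  assumes c: "\<And>n. c (Suc n) * (1 - b ^ Suc n) = c n * (1 - a * b ^ n)"
  shows "(\<Sum>n<M. c n * t ^ n) * (1 - t) + c M * (1 - b ^ M) * t ^ M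
    = (\<Sum>n<M. c n * (t * b) ^ n) * (1 - a * t)"
proof (induction M)
  case (Suc M)
  have "(\<Sum>n<Suc M. c n * t ^ n) * (1 - t) + c (Suc M) * (1 - b ^ Suc M) * t ^ Suc M
      = (\<Sum>n<M. c n * t ^ n) * (1 - t) + c M * (1 - b ^ M) * t ^ M
        + c M * (t * b) ^ M * (1 - a * t)"
    unfolding c by (simp add: algebra_simps)
  then show ?case
    unfolding Suc.IH by (simp add: algebra_simps)
qed simp

text \<open>
  The functional equation \<open>(1 - t) F(t) = (1 - a t) F(t b)\<close> is iterated; \<open>F(t b\<^sup>j)\<close> tends to 1.
\<close>

theorem q_binomial:
  fixes a t b :: "'a::comm_ring_1 fps"
  assumes t: "fps_nth t 0 = 0" and b: "fps_nth b 0 = 0"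
    and c0: "c 0 = 1" and c: "\<And>n. c (Suc n) * (1 - b ^ Suc n) = c n * (1 - a * b ^ n)"
    and F: "(\<lambda>n. c n * t ^ n) sums F"
  shows "F * qpoch_inf t b = qpoch_inf (a * t) b"
proof -
  define s where "s j = t * b ^ j" for j
  have s_low: "fps_nth (s j ^ n) i = 0" if "i < n" for i j n
    using that by (intro startsby_zero_power_prefix[rule_format, rotated]) (simp_all add: s_def t)
  have cs_low: "fps_nth (c n * s j ^ n) i = 0" if "i < n" for i j n
    unfolding fps_mult_nth using that by (intro sum.neutral) (simp add: s_low)
  \<comment> \<open>\<open>E j\<close> stands for F(t b^j); its coefficients are finite sums because
    \<open>s j ^ n\<close> has order at least \<open>n\<close>.\<close>
  define E where "E j = Abs_fps (\<lambda>N. \<Sum>n\<le>N. fps_nth (c n * s j ^ n) N)" for j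
  have E_sums: "(\<lambda>n. c n * s j ^ n) sums E j" for j
    by (rule fps_sumsI) (simp_all add: cs_low E_def)
  have E0: "F = E 0"
    using sums_unique2[OF F] E_sums[of 0] by (simp add: s_def)
  have E_rec: "E j * (1 - s j) = E (Suc j) * (1 - a * s j)" for j
  proof (rule LIMSEQ_unique)
    \<comment> \<open>The boundary term of the truncated equation has order at least
      \<open>M\<close>.\<close>
    have "(\<lambda>M. c M * (1 - b ^ M) * s j ^ M) \<longlonglongrightarrow> 0"
    proof (intro tendsto_fpsI eventually_sequentiallyI)
      fix i M :: nat assume "Suc i \<le> M"
      then show "fps_nth (c M * (1 - b ^ M) * s j ^ M) i = fps_nth 0 i"
        unfolding fps_mult_nth[of "c M * (1 - b ^ M)"] by (simp add: s_low)
    qed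
    from tendsto_add[OF tendsto_mult[OF E_sums[unfolded sums_def] tendsto_const] this]
    show "(\<lambda>M. (\<Sum>n<M. c n * s j ^ n) * (1 - s j) + c M * (1 - b ^ M) * s j ^ M)
        \<longlonglongrightarrow> E j * (1 - s j)"
      by simp
    have s_Suc: "s (Suc j) = s j * b"
      by (simp add: s_def mult_ac)
    show "(\<lambda>M. (\<Sum>n<M. c n * s j ^ n) * (1 - s j) + c M * (1 - b ^ M) * s j ^ M)
        \<longlonglongrightarrow> E (Suc j) * (1 - a * s j)"
      unfolding q_binomial_partial_sum[OF c] s_Suc[symmetric]
      by (intro tendsto_mult tendsto_const E_sums[unfolded sums_def])
  qed
  have iter: "E 0 * (\<Prod>j<K. 1 - t * b ^ j) = (\<Prod>j<K. 1 - (a * t) * b ^ j) * E K" for K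
  proof (induction K)
    case (Suc K)
    have "E 0 * (\<Prod>j<Suc K. 1 - t * b ^ j) = (E 0 * (\<Prod>j<K. 1 - t * b ^ j)) * (1 - s K)"
      by (simp add: s_def mult_ac)
    also have "\<dots> = (\<Prod>j<K. 1 - (a * t) * b ^ j) * (E K * (1 - s K))"
      by (simp only: Suc.IH mult.assoc)
    also have "\<dots> = (\<Prod>j<Suc K. 1 - (a * t) * b ^ j) * E (Suc K)"
      unfolding E_rec by (simp add: s_def mult_ac)
    finally show ?case .
  qed simp
  have b_low: "fps_nth (b ^ K) i = 0" if "i < K" for i K
    using that b by (intro startsby_zero_power_prefix[rule_format, rotated])
  have E_lim: "E \<longlonglongrightarrow> 1"
  proof (intro tendsto_fpsI eventually_sequentiallyI)
    fix i K :: nat assume K: "Suc i \<le> K"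
    have "fps_nth (c n * s K ^ n) i = 0" if "0 < n" for n
    proof -
      \<comment> \<open>For n > 0 the power b^(K n) contains b^K, which has order at least
        \<open>K\<close>. Hence only the term n = 0 reaches coefficients below
        \<open>K\<close>.\<close>
      have "c n * s K ^ n = (c n * t ^ n * b ^ (K * (n - 1))) * b ^ K"
        using that by (cases n) (simp_all add: s_def power_mult_distrib mult_ac flip: power_mult)
      then have "fps_nth (c n * s K ^ n) i = fps_nth ((c n * t ^ n * b ^ (K * (n - 1))) * b ^ K) i"
        by simp
      also have "\<dots> = 0"
        unfolding fps_mult_nth[of _ "b ^ K"] using K by (simp add: b_low)
      finally show ?thesis .
    qed
    then have "fps_nth (E K) i = (\<Sum>n\<in>{0}. fps_nth (c n * s K ^ n) i)"
      unfolding E_def fps_nth_Abs_fps by (intro sum.mono_neutral_right) auto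
    then show "fps_nth (E K) i = fps_nth 1 i"
      by (simp add: c0)
  qed
  show ?thesis
  proof (rule LIMSEQ_unique)
    show "(\<lambda>K. E 0 * (\<Prod>j<K. 1 - t * b ^ j)) \<longlonglongrightarrow> F * qpoch_inf t b"
      unfolding E0 by (intro tendsto_mult tendsto_const qpoch_inf_LIMSEQ t b)
    have "(\<lambda>K. (\<Prod>j<K. 1 - (a * t) * b ^ j) * E K) \<longlonglongrightarrow> qpoch_inf (a * t) b * 1"
      by (intro tendsto_mult E_lim qpoch_inf_LIMSEQ) (simp_all add: t b)
    then show "(\<lambda>K. E 0 * (\<Prod>j<K. 1 - t * b ^ j)) \<longlonglongrightarrow> qpoch_inf (a * t) b"
      by (simp add: iter)
  qed
qed

section \<open>Substitution into power series and infinite products\<close>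

lemma tendsto_fps_compose:
  fixes c :: "'a::comm_ring_1 fps"
  assumes "(f \<longlongrightarrow> g) F"
  shows "((\<lambda>x. f x oo c) \<longlongrightarrow> (g oo c)) F"
proof (rule tendsto_fpsI)
  fix n
  have "\<forall>\<^sub>F x in F. \<forall>i\<in>{0..n}. fps_nth (f x) i = fps_nth g i"
    using assms unfolding tendsto_fps_iff by (simp add: eventually_ball_finite_distrib)
  then show "\<forall>\<^sub>F x in F. fps_nth (f x oo c) n = fps_nth (g oo c) n"
    by eventually_elim (simp add: fps_compose_nth)
qed

text \<open>Substituting a series without constant term is a continuous ring homomorphism, so it can
  be carried out in the partial products. This permits replacing q by q^2 in product
  identities.\<close>

lemma qpoch_inf_compose:
  fixes a b c :: "'a::idom fps"
  assumes "fps_nth a 0 = 0" "fps_nth b 0 = 0" and c: "fps_nth c 0 = 0"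
  shows "qpoch_inf a b oo c = qpoch_inf (a oo c) (b oo c)"
proof (rule LIMSEQ_unique)
  show "(\<lambda>n. (\<Prod>k<n. 1 - a * b ^ k) oo c) \<longlonglongrightarrow> (qpoch_inf a b oo c)"
    by (intro tendsto_fps_compose qpoch_inf_LIMSEQ assms)
  have "((\<Prod>k<n. 1 - a * b ^ k) oo c) = (\<Prod>k<n. 1 - (a oo c) * (b oo c) ^ k)" for n
    by (simp add: fps_compose_prod_distrib[OF c] fps_compose_sub_distrib
        fps_compose_mult_distrib[OF c] fps_compose_power[OF c])
  then show "(\<lambda>n. (\<Prod>k<n. 1 - a * b ^ k) oo c) \<longlonglongrightarrow> qpoch_inf (a oo c) (b oo c)"
    using qpoch_inf_LIMSEQ[of "a oo c" "b oo c"] assms by simp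
qed

lemma fps_compose_X_square_nth:
  fixes f :: "'a::comm_ring_1 fps"
  shows "fps_nth (f oo fps_X ^ 2) n = (if even n then fps_nth f (n div 2) else 0)"
proof -
  have "fps_nth (f oo fps_X ^ 2) n = (\<Sum>i\<in>{0..n}. if n = 2 * i then fps_nth f i else 0)"
    by (simp add: fps_compose_nth if_distrib cong: if_cong flip: power_mult)
  also have "\<dots> = (\<Sum>i\<in>{0..n} \<inter> {i. n = 2 * i}. fps_nth f i)"
    by (simp add: sum.If_cases)
  also have "{0..n} \<inter> {i. n = 2 * i} = (if even n then {n div 2} else {})"
    by auto
  finally show ?thesis
    by simp
qed


section \<open>Generating functions of partitions\<close>

definition partitions_in :: "nat set \<Rightarrow> nat \<Rightarrow> nat multiset set" where
  "partitions_in S n = {\<pi>. set_mset \<pi> \<subseteq> S \<and> sum_mset \<pi> = n}"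

text \<open>For \<open>S\<close> without 0 this is the product of 1/(1 - w(k) q^k) over
  \<open>S\<close>. The weights let a power of z record how many parts satisfy a condition.\<close>

definition partition_gf :: "nat set \<Rightarrow> (nat \<Rightarrow> 'a::comm_ring_1) \<Rightarrow> 'a fps" where
  "partition_gf S w = Abs_fps (\<lambda>n. \<Sum>\<pi>\<in>partitions_in S n. \<Prod>k\<in>#\<pi>. w k)"

lemma part_le_sum_mset: "k \<in># \<pi> \<Longrightarrow> k \<le> sum_mset \<pi>" for k :: nat
  by (auto dest!: multi_member_split)

lemma size_le_sum_mset: "0 \<notin># \<pi> \<Longrightarrow> size \<pi> \<le> sum_mset \<pi>" for \<pi> :: "nat multiset"
  by (induction \<pi>) auto

lemma finite_partitions_in:
  assumes "0 \<notin> S"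
  shows "finite (partitions_in S n)"
proof (rule finite_subset)
  show "partitions_in S n \<subseteq> (\<Union>k\<in>{..n}. multisets_of_size {..n} k)"
  proof
    fix \<pi> assume "\<pi> \<in> partitions_in S n"
    then have "0 \<notin># \<pi>" "sum_mset \<pi> = n"
      using assms by (auto simp: partitions_in_def)
    then have "set_mset \<pi> \<subseteq> {..n}" "size \<pi> \<le> n"
      using size_le_sum_mset[of \<pi>] part_le_sum_mset[of _ \<pi>] by blast+
    then show "\<pi> \<in> (\<Union>k\<in>{..n}. multisets_of_size {..n} k)"
      by (simp add: multisets_of_size_def)
  qed
qed (auto intro: finite_multisets_of_size)

lemma partitions_in_0:
  assumes "0 \<notin> S"
  shows "partitions_in S 0 = {{#}}"
proof -
  have "\<pi> = {#}" if "\<pi> \<in> partitions_in S 0" for \<pi>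
    using that assms by (cases \<pi>) (auto simp: partitions_in_def)
  then show ?thesis
    by (auto simp: partitions_in_def)
qed

lemma partitions_in_eq_empty:
  assumes "0 < n" "\<And>k. k \<in> S \<Longrightarrow> n < k"
  shows "partitions_in S n = {}"
proof -
  have False if \<pi>: "\<pi> \<in> partitions_in S n" for \<pi>
  proof -
    have "\<pi> \<noteq> {#}"
      using \<pi> assms(1) by (auto simp: partitions_in_def)
    then obtain k where "k \<in># \<pi>"
      by blast
    with \<pi> assms(2)[of k] part_le_sum_mset[of k \<pi>] show False
      by (auto simp: partitions_in_def)
  qed
  then show ?thesis by blast
qed

text \<open>A partition avoids \<open>k\<close> or loses one copy of it. Further copies may remain,
  so \<open>insert k S\<close> recurs on the right, which amounts to a geometric series.\<close>

lemma partitions_in_insert: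
  assumes "k \<notin> S"
  shows "partitions_in (insert k S) n =
    partitions_in S n \<union> (if k \<le> n then add_mset k ` partitions_in (insert k S) (n - k) else {})"
    (is "?L = ?R")
proof
  show "?L \<subseteq> ?R"
  proof
    fix \<pi> assume \<pi>: "\<pi> \<in> ?L"
    show "\<pi> \<in> ?R"
    proof (cases "k \<in># \<pi>")
      case True
      then obtain \<sigma> where "\<pi> = add_mset k \<sigma>"
        by (meson multi_member_split)
      with \<pi> show ?thesis
        by (auto simp: partitions_in_def)
    next
      case False
      with \<pi> show ?thesis
        by (auto simp: partitions_in_def)
    qed
  qed
qed (auto simp: partitions_in_def split: if_splits)

text \<open>Splitting by the presence of \<open>k\<close> gives P = Q + w(k) q^k P for the two
  series; the last term is moved across instead of dividing.\<close>

lemma partition_gf_insert: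
  assumes k: "k \<notin> S" "0 < k" and S: "0 \<notin> S"
  shows "partition_gf (insert k S) w * (1 - fps_const (w k) * fps_X ^ k) = partition_gf S w"
proof (rule fps_ext)
  fix n
  let ?f = "\<lambda>\<pi>. \<Prod>k\<in>#\<pi>. w k"
  have fin: "finite (partitions_in S n)" "finite (partitions_in (insert k S) n)" for n
    using assms by (auto intro!: finite_partitions_in)
  have disj: "partitions_in S n \<inter> add_mset k ` T = {}" for T
    using k(1) by (auto simp: partitions_in_def)
  have "fps_nth (partition_gf (insert k S) w) n =
      fps_nth (partition_gf S w) n
      + (if k \<le> n then w k * fps_nth (partition_gf (insert k S) w) (n - k) else 0)"
  proof (cases "k \<le> n")
    case True
    have "fps_nth (partition_gf (insert k S) w) n =
      sum ?f (partitions_in S n) + sum ?f (add_mset k ` partitions_in (insert k S) (n - k))"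
      unfolding partition_gf_def fps_nth_Abs_fps partitions_in_insert[OF k(1), of n] if_P[OF True]
      using fin disj by (intro sum.union_disjoint) simp_all
    also have "sum ?f (add_mset k ` partitions_in (insert k S) (n - k)) =
        w k * sum ?f (partitions_in (insert k S) (n - k))"
      by (subst sum.reindex) (auto simp: sum_distrib_left intro: inj_onI)
    finally show ?thesis
      using True by (simp add: partition_gf_def)
  next
    case False
    then show ?thesis
      by (simp add: partition_gf_def partitions_in_insert[OF k(1), of n])
  qed
  moreover have "fps_nth (partition_gf (insert k S) w * (fps_const (w k) * fps_X ^ k)) n =
      (if k \<le> n then w k * fps_nth (partition_gf (insert k S) w) (n - k) else 0)"
    by (simp add: fps_X_power_mult_right_nth mult.assoc[symmetric] mult.commute[of _ "fps_const _"])
  ultimately show "fps_nth (partition_gf (insert k S) w * (1 - fps_const (w k) * fps_X ^ k)) n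
      = fps_nth (partition_gf S w) n"
    by (simp add: right_diff_distrib)
qed

lemma partition_gf_insert_max:
  assumes "m \<le> Suc n" "0 < m"
  shows "partition_gf {m..Suc n} w * (1 - fps_const (w (Suc n)) * fps_X ^ Suc n) = partition_gf {m..n} w"
  using partition_gf_insert[of "Suc n" "{m..n}" w] assms by (simp add: atLeastAtMostSuc_conv)

lemma partition_gf_insert_min:
  assumes "m \<le> n" "0 < m"
  shows "partition_gf {m..n} w * (1 - fps_const (w m) * fps_X ^ m) = partition_gf {Suc m..n} w"
  using partition_gf_insert[of m "{Suc m..n}" w] assms by (simp add: atLeastAtMost_insertL)

lemma partition_gf_empty [simp]: "partition_gf {} w = 1"
proof (rule fps_ext)
  have "partitions_in {} n = (if n = 0 then {{#}} else {})" for n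
    by (auto simp: partitions_in_def)
  then show "fps_nth (partition_gf {} w) n = fps_nth 1 n" for n
    by (simp add: partition_gf_def)
qed

lemma partition_gf_Un:
  assumes "finite A" "A \<inter> B = {}" "0 \<notin> A" "0 \<notin> B"
  shows "partition_gf (A \<union> B) w * (\<Prod>k\<in>A. 1 - fps_const (w k) * fps_X ^ k) = partition_gf B w"
  using assms
proof (induction A)
  case (insert k A)
  then have "partition_gf (insert k (A \<union> B)) w * (1 - fps_const (w k) * fps_X ^ k) =
      partition_gf (A \<union> B) w"
    by (intro partition_gf_insert) auto
  with insert show ?case
    by (simp add: mult.assoc[symmetric])
qed simp

lemma partition_gf_finite:
  assumes "finite A" "0 \<notin> A"
  shows "partition_gf A w * (\<Prod>k\<in>A. 1 - fps_const (w k) * fps_X ^ k) = 1"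
  using partition_gf_Un[of A "{}" w] assms by simp

lemma partition_gf_cong:
  assumes "\<And>k. k \<in> S \<Longrightarrow> w k = w' k"
  shows "partition_gf S w = partition_gf S w'"
proof -
  have "(\<Prod>k\<in>#\<pi>. w k) = (\<Prod>k\<in>#\<pi>. w' k)" if "\<pi> \<in> partitions_in S n" for \<pi> n
    using that assms by (intro arg_cong[of _ _ prod_mset] image_mset_cong) (auto simp: partitions_in_def)
  then show ?thesis
    unfolding partition_gf_def by (intro arg_cong[of _ _ Abs_fps] ext sum.cong refl)
qed

text \<open>The parts m, m + 1, ... are removed one by one, each contributing a factor. With all
  parts at least \<open>K\<close>, only the empty partition has size below \<open>K\<close>, so the
  remaining series tends to 1.\<close>

lemma partition_gf_atLeast:
  assumes m: "0 < m"
  shows "partition_gf {m..} (\<lambda>_. c) * qpoch_inf (fps_const c * fps_X ^ m) fps_X = 1"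
proof (rule LIMSEQ_unique)
  let ?P = "\<lambda>m. partition_gf {m..} (\<lambda>_. c)"
  show "(\<lambda>K. ?P m * (\<Prod>k<K. 1 - (fps_const c * fps_X ^ m) * fps_X ^ k))
      \<longlonglongrightarrow> ?P m * qpoch_inf (fps_const c * fps_X ^ m) fps_X"
    using m by (intro tendsto_mult tendsto_const qpoch_inf_LIMSEQ) simp_all
  have step: "?P j * (1 - fps_const c * fps_X ^ j) = ?P (Suc j)" if "m \<le> j" for j
  proof -
    have "{j..} = insert j {Suc j..}"
      by auto
    then show ?thesis
      using partition_gf_insert[of j "{Suc j..}" "\<lambda>_. c"] that m by simp
  qed
  have prod: "?P m * (\<Prod>k<K. 1 - (fps_const c * fps_X ^ m) * fps_X ^ k) = ?P (m + K)" for K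
  proof (induction K)
    case (Suc K)
    then show ?case
      using step[of "m + K"] by (simp add: mult.assoc[symmetric] power_add)
  qed simp
  have "?P \<longlonglongrightarrow> 1"
  proof (intro tendsto_fpsI eventually_sequentiallyI)
    fix n K :: nat assume "Suc n \<le> K"
    then have "partitions_in {K..} n = (if n = 0 then {{#}} else {})"
      using partitions_in_0[of "{K..}"] partitions_in_eq_empty[of n "{K..}"] by auto
    then show "fps_nth (?P K) n = fps_nth 1 n"
      by (simp add: partition_gf_def)
  qed
  then have "(\<lambda>K. ?P (K + m)) \<longlonglongrightarrow> 1"
    by (rule LIMSEQ_ignore_initial_segment)
  then show "(\<lambda>K. ?P m * (\<Prod>k<K. 1 - (fps_const c * fps_X ^ m) * fps_X ^ k)) \<longlonglongrightarrow> 1"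
    by (simp add: prod add.commute)
qed

section \<open>Partitions into distinct parts\<close>

definition distinct_partitions_in :: "nat set \<Rightarrow> nat \<Rightarrow> nat multiset set" where
  "distinct_partitions_in S n = {\<pi> \<in> partitions_in S n. \<forall>k. count \<pi> k \<le> 1}"

definition distinct_partition_gf :: "nat set \<Rightarrow> 'a::comm_ring_1 fps" where
  "distinct_partition_gf S = Abs_fps (\<lambda>n. of_nat (card (distinct_partitions_in S n)))"

lemma finite_distinct_partitions_in: "0 \<notin> S \<Longrightarrow> finite (distinct_partitions_in S n)"
  by (simp add: distinct_partitions_in_def finite_partitions_in)

lemma distinct_partitions_in_0: "0 \<notin> S \<Longrightarrow> distinct_partitions_in S 0 = {{#}}"
  by (simp add: distinct_partitions_in_def partitions_in_0 conj_commute cong: conj_cong)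

lemma distinct_partitions_in_eq_empty:
  "0 < n \<Longrightarrow> (\<And>k. k \<in> S \<Longrightarrow> n < k) \<Longrightarrow> distinct_partitions_in S n = {}"
  by (simp add: distinct_partitions_in_def partitions_in_eq_empty)

text \<open>By distinctness no second copy of \<open>k\<close> remains after removing one, so the
  second set uses \<open>S\<close>; this is the source of the factor 1 + q^k.\<close>

lemma distinct_partitions_in_insert:
  assumes "k \<notin> S"
  shows "distinct_partitions_in (insert k S) n =
    distinct_partitions_in S n \<union> (if k \<le> n then add_mset k ` distinct_partitions_in S (n - k) else {})"
    (is "?L = ?R")
proof
  show "?L \<subseteq> ?R"
  proof
    fix \<pi> assume \<pi>: "\<pi> \<in> ?L"
    show "\<pi> \<in> ?R"
    proof (cases "k \<in># \<pi>")
      case True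
      then obtain \<sigma> where \<sigma>: "\<pi> = add_mset k \<sigma>"
        by (meson multi_member_split)
      with \<pi> have c: "count (add_mset k \<sigma>) j \<le> 1" for j
        by (simp add: distinct_partitions_in_def)
      from c[of k] have "k \<notin># \<sigma>"
        by (simp add: not_in_iff)
      moreover have "count \<sigma> j \<le> 1" for j
        using c[of j] by (cases "j = k") auto
      ultimately show ?thesis
        using \<pi> \<sigma> by (auto simp: distinct_partitions_in_def partitions_in_def)
    next
      case False
      with \<pi> show ?thesis
        by (auto simp: distinct_partitions_in_def partitions_in_def)
    qed
  qed
  show "?R \<subseteq> ?L"
    using assms by (auto simp: distinct_partitions_in_def partitions_in_def not_in_iff split: if_splits)
qed

lemma distinct_partition_gf_insert:
  assumes k: "k \<notin> S" and S: "0 \<notin> S"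
  shows "distinct_partition_gf (insert k S) = distinct_partition_gf S * (1 + fps_X ^ k)"
proof (rule fps_ext)
  fix n
  note fin = finite_distinct_partitions_in[OF S]
  have disj: "distinct_partitions_in S n \<inter> add_mset k ` T = {}" for T
    using k by (auto simp: distinct_partitions_in_def partitions_in_def)
  have "card (distinct_partitions_in (insert k S) n) = card (distinct_partitions_in S n)
      + (if k \<le> n then card (distinct_partitions_in S (n - k)) else 0)"
  proof (cases "k \<le> n")
    case True
    have "card (distinct_partitions_in (insert k S) n) = card (distinct_partitions_in S n)
      + card (add_mset k ` distinct_partitions_in S (n - k))"
      unfolding distinct_partitions_in_insert[OF k] if_P[OF True]
      using fin disj by (intro card_Un_disjoint) simp_all
    also have "card (add_mset k ` distinct_partitions_in S (n - k)) = card (distinct_partitions_in S (n - k))"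
      by (intro card_image inj_onI) auto
    finally show ?thesis
      using True by simp
  qed (simp add: distinct_partitions_in_insert[OF k])
  then show "fps_nth (distinct_partition_gf (insert k S)) n
      = fps_nth (distinct_partition_gf S * (1 + fps_X ^ k) :: 'a fps) n"
    by (simp add: distinct_partition_gf_def distrib_left fps_X_power_mult_right_nth)
qed

text \<open>The odd parts are removed in increasing order and give the factors 1 + q^(2m+1); the
  remaining series tends to 1.\<close>

lemma distinct_odd_partition_gf:
  "distinct_partition_gf {k. odd k} = (qpoch_inf (- fps_X) (fps_X ^ 2) :: 'a::comm_ring_1 fps)"
proof (rule LIMSEQ_unique)
  \<comment> \<open>For odd \<open>k\<close> the bound is the same as
    \<open>2 * m + 1 \<le> k\<close>, and \<open>m = 0\<close> admits every odd part.\<close>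
  let ?S = "\<lambda>m. {k. odd k \<and> 2 * m \<le> k} :: nat set"
  let ?P = "\<lambda>m. distinct_partition_gf (?S m) :: 'a fps"
  have step: "?P m = ?P (Suc m) * (1 + fps_X ^ (2 * m + 1))" for m
  proof -
    have "?S m = insert (2 * m + 1) (?S (Suc m))"
      by (auto elim!: oddE)
    then show ?thesis
      using distinct_partition_gf_insert[of "2 * m + 1" "?S (Suc m)"] by simp
  qed
  have prod: "?P 0 = (\<Prod>k<K. 1 - (- fps_X) * (fps_X ^ 2) ^ k) * ?P K" for K
  proof (induction K)
    case (Suc K)
    then show ?case
      using step[of K] by (simp add: mult_ac flip: power_mult)
  qed simp
  show "(\<lambda>K. ?P 0) \<longlonglongrightarrow> distinct_partition_gf {k. odd k}"
    by simp
  have "?P \<longlonglongrightarrow> 1"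
  proof (intro tendsto_fpsI eventually_sequentiallyI)
    fix n K :: nat assume K: "Suc n \<le> K"
    have "distinct_partitions_in (?S K) n = (if n = 0 then {{#}} else {})"
    proof (cases "n = 0")
      case True
      moreover have "distinct_partitions_in (?S K) 0 = {{#}}"
        by (rule distinct_partitions_in_0) simp
      ultimately show ?thesis
        by simp
    next
      case False
      with K have "distinct_partitions_in (?S K) n = {}"
        by (intro distinct_partitions_in_eq_empty) auto
      with False show ?thesis
        by simp
    qed
    then show "fps_nth (?P K) n = fps_nth 1 n"
      by (simp add: distinct_partition_gf_def)
  qed
  then have "(\<lambda>K. (\<Prod>k<K. 1 - (- fps_X) * (fps_X ^ 2) ^ k) * ?P K) \<longlonglongrightarrow> qpoch_inf (- fps_X) (fps_X ^ 2) * 1"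
    by (intro tendsto_mult qpoch_inf_LIMSEQ) simp_all
  then show "(\<lambda>K. ?P 0) \<longlonglongrightarrow> qpoch_inf (- fps_X) (fps_X ^ 2)"
    by (simp only: prod[symmetric] mult_1_right)
qed


section \<open>The Andrews--Garvan crank identity\<close>

abbreviation zpow :: "int \<Rightarrow> laurent" where
  "zpow k \<equiv> Poly_Mapping.single k 1"

lemma zpow_power: "zpow k ^ n = zpow (int n * k)"
  by (induction n) (simp_all add: Poly_Mapping.mult_single algebra_simps)

text \<open>The empty partition, for which the crank is meaningless, is excluded.\<close>

definition crank_gf :: "laurent fps" where
  "crank_gf = Abs_fps (\<lambda>n. \<Sum>\<pi>\<in>partitions_in {1..} n - {{#}}. zpow (crank \<pi>))"

section \<open>Sorting by the number of ones and by the largest part\<close>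

text \<open>Enumerates the partitions without ones whose largest part, hence crank, is
  \<open>l\<close>. The factor z^l q^l stands for one copy of that part; no such partition has
  \<open>l < 2\<close>.\<close>

definition gf_no_ones :: "nat \<Rightarrow> laurent fps" where
  "gf_no_ones l = (if l < 2 then 0 else fps_const (zpow (int l)) * fps_X ^ l * partition_gf {2..l} (\<lambda>_. 1))"

text \<open>Enumerates the partitions with exactly \<open>j > 0\<close> ones: the ones give z^(-j)
  q^j and each part exceeding \<open>j\<close> gives z, so the exponent of z is the crank.\<close>

definition gf_ones :: "nat \<Rightarrow> laurent fps" where
  "gf_ones j = (if j = 0 then 0 else
     fps_const (zpow (- int j)) * fps_X ^ j * partition_gf {2..} (\<lambda>k. if j < k then zpow 1 else 1))"

text \<open>Removing one copy of the largest part is a bijection onto the partitions of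
  \<open>n - l\<close> with parts from 2 to \<open>l\<close> when \<open>l \<le> n\<close>;
  otherwise both sides vanish.\<close>

lemma gf_no_ones_nth:
  assumes "2 \<le> l"
  shows "fps_nth (gf_no_ones l) n =
    (\<Sum>\<pi> | \<pi> \<in> partitions_in {2..} n \<and> \<pi> \<noteq> {#} \<and> Max_mset \<pi> = l. zpow (crank \<pi>))"
proof -
  have crank: "crank \<pi> = int (Max_mset \<pi>)" if "\<pi> \<in> partitions_in {2..} n" for \<pi>
  proof -
    have "1 \<notin># \<pi>"
      using that by (auto simp: partitions_in_def)
    then show ?thesis
      by (simp add: crank_def num_ones_def largest_part_def not_in_iff)
  qed
  show ?thesis
  proof (cases "n < l")
    case True
    have False if \<pi>: "\<pi> \<in> partitions_in {2..} n" "\<pi> \<noteq> {#}" "Max_mset \<pi> = l" for \<pi>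
    proof -
      have "l \<in># \<pi>"
        using \<pi>(2,3) Max_in[of "set_mset \<pi>"] by auto
      from part_le_sum_mset[OF this] \<pi>(1) True show False
        by (simp add: partitions_in_def)
    qed
    then have "{\<pi> \<in> partitions_in {2..} n. \<pi> \<noteq> {#} \<and> Max_mset \<pi> = l} = {}"
      by blast
    moreover have "fps_nth (gf_no_ones l) n = 0"
      using True unfolding gf_no_ones_def by (simp add: fps_nth_const_X_power_mult)
    ultimately show ?thesis
      by (simp only: sum.empty)
  next
    case False
    have "(\<Sum>\<pi> | \<pi> \<in> partitions_in {2..} n \<and> \<pi> \<noteq> {#} \<and> Max_mset \<pi> = l. zpow (crank \<pi>)) =
        (\<Sum>\<sigma>\<in>partitions_in {2..l} (n - l). zpow (int l))"
    proof (rule sum.reindex_bij_witness[where i = "add_mset l" and j = "\<lambda>\<pi>. \<pi> - {#l#}"])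
      fix \<pi> assume \<pi>: "\<pi> \<in> {\<pi> \<in> partitions_in {2..} n. \<pi> \<noteq> {#} \<and> Max_mset \<pi> = l}"
      then have "l \<in># \<pi>"
        using Max_in[of "set_mset \<pi>"] by auto
      then obtain \<sigma> where \<sigma>: "\<pi> = add_mset l \<sigma>"
        by (meson multi_member_split)
      show "add_mset l (\<pi> - {#l#}) = \<pi>"
        by (simp add: \<sigma>)
      have "k \<le> l" if "k \<in># \<sigma>" for k
        using \<pi> that Max_ge[of "set_mset \<pi>" k] by (simp add: \<sigma>)
      then show "\<pi> - {#l#} \<in> partitions_in {2..l} (n - l)"
        using \<pi> by (auto simp: \<sigma> partitions_in_def)
      show "zpow (int l) = zpow (crank \<pi>)"
        using \<pi> crank by simp
    next
      fix \<sigma> assume \<sigma>: "\<sigma> \<in> partitions_in {2..l} (n - l)"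
      show "add_mset l \<sigma> - {#l#} = \<sigma>"
        by simp
      have "Max (insert l (set_mset \<sigma>)) = l"
        using \<sigma> by (intro Max_eqI) (auto simp: partitions_in_def)
      then show "add_mset l \<sigma> \<in> {\<pi> \<in> partitions_in {2..} n. \<pi> \<noteq> {#} \<and> Max_mset \<pi> = l}"
        using \<sigma> False assms by (auto simp: partitions_in_def)
    qed
    also have "\<dots> = fps_nth (gf_no_ones l) n"
      using False assms unfolding gf_no_ones_def
      by (simp add: fps_nth_const_X_power_mult partition_gf_def mult.commute[of "of_nat _"])
    finally show ?thesis ..
  qed
qed

lemma gf_ones_nth:
  assumes "1 \<le> j"
  shows "fps_nth (gf_ones j) n =
    (\<Sum>\<pi> | \<pi> \<in> partitions_in {1..} n \<and> count \<pi> 1 = j. zpow (crank \<pi>))"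
proof (cases "n < j")
  case True
  have "count \<pi> 1 \<noteq> j" if "\<pi> \<in> partitions_in {1..} n" for \<pi>
    using that True count_le_size[of \<pi> 1] size_le_sum_mset[of \<pi>] by (fastforce simp: partitions_in_def)
  then have "{\<pi> \<in> partitions_in {1..} n. count \<pi> 1 = j} = {}"
    by blast
  moreover have "fps_nth (gf_ones j) n = 0"
    using True unfolding gf_ones_def by (simp add: fps_nth_const_X_power_mult)
  ultimately show ?thesis
    by (simp only: sum.empty)
next
  case False
  let ?w = "\<lambda>k. if j < k then zpow 1 else 1"
  have w: "(\<Prod>k\<in>#\<sigma>. ?w k) = zpow (int (size {#k \<in># \<sigma>. j < k#}))" for \<sigma> :: "nat multiset"
    by (induction \<sigma>) (simp_all add: Poly_Mapping.mult_single)
  have "(\<Sum>\<pi> | \<pi> \<in> partitions_in {1..} n \<and> count \<pi> 1 = j. zpow (crank \<pi>)) =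
      (\<Sum>\<sigma>\<in>partitions_in {2..} (n - j). zpow (- int j) * (\<Prod>k\<in>#\<sigma>. ?w k))"
  proof (rule sum.reindex_bij_witness[where i = "\<lambda>\<sigma>. \<sigma> + replicate_mset j 1" and j = "filter_mset (\<lambda>k. k \<noteq> 1)"])
    fix \<pi> assume \<pi>: "\<pi> \<in> {\<pi> \<in> partitions_in {1..} n. count \<pi> 1 = j}"
    define \<sigma> where "\<sigma> = filter_mset (\<lambda>k. k \<noteq> 1) \<pi>"
    have eq: "\<pi> = \<sigma> + replicate_mset j 1"
      using \<pi> by (intro multiset_eqI) (auto simp: \<sigma>_def)
    then show "filter_mset (\<lambda>k. k \<noteq> 1) \<pi> + replicate_mset j 1 = \<pi>"
      by (simp add: \<sigma>_def)
    have "sum_mset \<pi> = sum_mset \<sigma> + j"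
      by (subst eq) simp
    moreover have "set_mset \<sigma> \<subseteq> {2..}"
    proof
      fix k assume "k \<in># \<sigma>"
      then have "k \<in># \<pi>" "k \<noteq> 1"
        by (auto simp: \<sigma>_def)
      with \<pi> show "k \<in> {2..}"
        by (cases "k = 0") (auto simp: partitions_in_def)
    qed
    ultimately have "\<sigma> \<in> partitions_in {2..} (n - j)"
      using \<pi> by (auto simp: partitions_in_def)
    then show "filter_mset (\<lambda>k. k \<noteq> 1) \<pi> \<in> partitions_in {2..} (n - j)"
      by (simp only: \<sigma>_def)
    \<comment> \<open>As \<open>j\<close> is at least 1, no one exceeds \<open>j\<close>, so
      removing the ones does not change the count.\<close>
    have "{#k \<in># \<pi>. j < k#} = {#k \<in># \<sigma>. j < k#}"
      using assms by (subst eq) (auto simp: filter_mset_eq_conv)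
    then have "crank \<pi> = int (size {#k \<in># \<sigma>. j < k#}) - int j"
      using \<pi> assms by (simp add: crank_def num_ones_def num_parts_gt_ones_def)
    then show "zpow (- int j) * (\<Prod>k\<in>#filter_mset (\<lambda>k. k \<noteq> 1) \<pi>. ?w k) = zpow (crank \<pi>)"
      unfolding w \<sigma>_def[symmetric] by (simp add: Poly_Mapping.mult_single)
  next
    fix \<sigma> assume \<sigma>: "\<sigma> \<in> partitions_in {2..} (n - j)"
    then have "1 \<notin># \<sigma>"
      by (auto simp: partitions_in_def)
    then show "filter_mset (\<lambda>k. k \<noteq> 1) (\<sigma> + replicate_mset j 1) = \<sigma>"
      by (intro multiset_eqI) (auto simp: not_in_iff)
    show "\<sigma> + replicate_mset j 1 \<in> {\<pi> \<in> partitions_in {1..} n. count \<pi> 1 = j}"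
      using \<sigma> False \<open>1 \<notin># \<sigma>\<close> by (auto simp: partitions_in_def not_in_iff split: if_splits)
  qed
  also have "\<dots> = fps_nth (gf_ones j) n"
    using False assms unfolding gf_ones_def
    by (simp add: fps_nth_const_X_power_mult partition_gf_def sum_distrib_left)
  finally show ?thesis ..
qed

text \<open>Partitions are grouped by the number of ones, and those without ones again by the
  largest part. The index \<open>i\<close> is the number of ones in the first summand and the
  largest part in the second.\<close>

lemma crank_gf_sums: "(\<lambda>i. gf_ones i + gf_no_ones i) sums crank_gf"
proof (rule fps_sumsI)
  fix n i :: nat assume "i < n"
  then show "fps_nth (gf_ones n + gf_no_ones n) i = 0"
    by (simp add: gf_ones_def gf_no_ones_def fps_nth_const_X_power_mult)
next
  fix N
  let ?P = "partitions_in {1..} N - {{#}}" and ?Q = "{\<pi> \<in> partitions_in {2..} N. \<pi> \<noteq> {#}}"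
  have fin: "finite ?P" "finite ?Q"
    by (simp_all add: finite_partitions_in)
  have count: "count \<pi> 1 \<le> N" if "\<pi> \<in> ?P" for \<pi>
    using that count_le_size[of \<pi> 1] size_le_sum_mset[of \<pi>] by (fastforce simp: partitions_in_def)
  have max: "Max_mset \<pi> \<in> {2..N}" if "\<pi> \<in> ?Q" for \<pi>
    using that part_le_sum_mset[of "Max_mset \<pi>" \<pi>] Max_in[of "set_mset \<pi>"]
    by (auto simp: partitions_in_def simp del: Max_in)
  have no_ones: "{\<pi> \<in> ?P. count \<pi> 1 = 0} = ?Q"
  proof -
    have "(\<forall>k\<in>#\<pi>. 1 \<le> k) \<and> 1 \<notin># \<pi> \<longleftrightarrow> (\<forall>k\<in>#\<pi>. 2 \<le> k)" for \<pi> :: "nat multiset"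
      by (metis One_nat_def Suc_1 Suc_leI le_neq_implies_less not_less_eq_eq order_refl order.trans one_le_numeral)
    then show ?thesis
      by (auto simp: partitions_in_def subset_iff count_eq_zero_iff)
  qed
  have ones: "{\<pi> \<in> ?P. count \<pi> 1 = j} = {\<pi> \<in> partitions_in {1..} N. count \<pi> 1 = j}" if "1 \<le> j" for j
    using that by auto
  have "fps_nth crank_gf N = (\<Sum>j\<in>{..N}. \<Sum>\<pi> | \<pi> \<in> ?P \<and> count \<pi> 1 = j. zpow (crank \<pi>))"
    unfolding crank_gf_def fps_nth_Abs_fps using fin count by (intro sum.group[symmetric]) auto
  also have "\<dots> = (\<Sum>\<pi>\<in>?Q. zpow (crank \<pi>)) + (\<Sum>j\<in>{1..N}. fps_nth (gf_ones j) N)"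
  proof -
    have "(\<Sum>\<pi> | \<pi> \<in> ?P \<and> count \<pi> 1 = j. zpow (crank \<pi>)) = fps_nth (gf_ones j) N" if "j \<in> {1..N}" for j
    proof -
      have "1 \<le> j"
        using that by simp
      then show ?thesis
        by (simp only: ones gf_ones_nth)
    qed
    moreover have "sum g {..N} = g 0 + sum g {1..N}" for g :: "nat \<Rightarrow> laurent"
    proof -
      have "{..N} = insert 0 {1..N}"
        by auto
      then show ?thesis
        by simp
    qed
    ultimately show ?thesis
      unfolding no_ones[symmetric] by (simp only: cong: sum.cong)
  qed
  also have "(\<Sum>\<pi>\<in>?Q. zpow (crank \<pi>)) =
      (\<Sum>l\<in>{2..N}. \<Sum>\<pi> | \<pi> \<in> ?Q \<and> Max_mset \<pi> = l. zpow (crank \<pi>))"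
    using fin max by (intro sum.group[symmetric]) auto
  also have "\<dots> = (\<Sum>l\<in>{2..N}. fps_nth (gf_no_ones l) N)"
    by (intro sum.cong refl) (simp add: gf_no_ones_nth conj_assoc)
  also have "\<dots> = (\<Sum>l\<in>{..N}. fps_nth (gf_no_ones l) N)"
    by (intro sum.mono_neutral_left) (auto simp: gf_no_ones_def)
  also have "(\<Sum>j\<in>{1..N}. fps_nth (gf_ones j) N) = (\<Sum>j\<in>{..N}. fps_nth (gf_ones j) N)"
    by (intro sum.mono_neutral_left) (auto simp: gf_ones_def)
  finally show "fps_nth crank_gf N = (\<Sum>n\<le>N. fps_nth (gf_ones n + gf_no_ones n) N)"
    by (simp add: sum.distrib)
qed

section \<open>Evaluation of the crank generating function as an infinite product\<close>

text \<open>The parts above \<open>j\<close> have weight z and give 1/(z q^(j+1);q)_inf, which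
  cancels the tail of (zq;q)_inf. The first \<open>j\<close> factors of that product remain.\<close>

lemma gf_ones_mult_qpoch:
  assumes j: "1 \<le> j"
  shows "gf_ones j * qpoch_inf (z_var * q_var) q_var = fps_const (zpow (- int j)) * fps_X ^ j *
    ((\<Prod>k<j. 1 - z_var * q_var * q_var ^ k) * partition_gf {2..j} (\<lambda>_. 1))"
proof -
  let ?w = "\<lambda>k. if j < k then zpow 1 else 1"
  let ?D = "\<Prod>k\<in>{2..j}. 1 - fps_const (1 :: laurent) * fps_X ^ k"
  have D: "?D = (\<Prod>k\<in>{2..j}. 1 - fps_const (?w k) * fps_X ^ k)"
    by (intro prod.cong refl) simp
  have "{2..} = {2..j} \<union> {Suc j..}"
    using j by auto
  then have "partition_gf {2..} ?w * ?D = partition_gf {Suc j..} ?w"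
    unfolding D by (simp only:) (intro partition_gf_Un; auto)
  also have "\<dots> = partition_gf {Suc j..} (\<lambda>_. zpow 1)"
    by (intro partition_gf_cong) auto
  finally have split: "partition_gf {2..} ?w * ?D = partition_gf {Suc j..} (\<lambda>_. zpow 1)" .
  \<comment> \<open>\<open>?D\<close> and \<open>partition_gf {2..j}\<close> are inverse to each
    other, so their product may be inserted.\<close>
  have "partition_gf {2..} ?w = (partition_gf {2..} ?w * ?D) * partition_gf {2..j} (\<lambda>_. 1)"
    using partition_gf_finite[of "{2..j}" "\<lambda>_. 1 :: laurent"] by (simp add: mult_ac)
  also have "\<dots> * qpoch_inf (z_var * q_var) q_var =
      (partition_gf {Suc j..} (\<lambda>_. zpow 1) * qpoch_inf (z_var * q_var ^ Suc j) q_var) *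
      ((\<Prod>k<j. 1 - z_var * q_var * q_var ^ k) * partition_gf {2..j} (\<lambda>_. 1))"
    unfolding split using qpoch_inf_split[of "z_var * q_var" q_var j] by (simp add: mult_ac)
  also have "partition_gf {Suc j..} (\<lambda>_. zpow 1) * qpoch_inf (z_var * q_var ^ Suc j) q_var = 1"
    by (rule partition_gf_atLeast) simp
  finally show ?thesis
    using j by (simp add: gf_ones_def mult.assoc)
qed

theorem crank_gf_product:
  "(1 + (z_var - 1) * q_var + crank_gf) * qpoch_inf (z_var * q_var) q_var
    * qpoch_inf (z_inv * q_var) q_var = qpoch_inf q_var q_var"
proof -
  let ?p = "\<lambda>m n. partition_gf {m..n} (\<lambda>_. 1) :: laurent fps"
  let ?Z = "qpoch_inf (z_var * q_var) q_var" and ?W = "qpoch_inf (z_inv * q_var) q_var"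
  have p_rec: "?p 1 (Suc n) * (1 - q_var ^ Suc n) = ?p 1 n" for n
    using partition_gf_insert_max[of 1 n "\<lambda>_. 1 :: laurent"] by simp
  have p_1: "?p 1 n * (1 - q_var) = ?p 2 n" if "1 \<le> n" for n
    using partition_gf_insert_min[of 1 n "\<lambda>_. 1 :: laurent"] that by (simp add: numeral_2_eq_2)

  \<comment> \<open>\<open>?p 1 n\<close> is 1/(q;q)_n, so \<open>E\<close> is Euler's series for
    1/(zq;q)_inf, the case a = 0 of the q-binomial theorem.\<close>
  define E where "E = Abs_fps (\<lambda>N. \<Sum>n\<le>N. fps_nth (?p 1 n * (z_var * q_var) ^ n) N)"
  have E: "(\<lambda>n. ?p 1 n * (z_var * q_var) ^ n) sums E"
    by (rule fps_sumsI)
      (simp_all add: E_def power_mult_distrib fps_X_power_mult_right_nth flip: mult.assoc)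
  have "E * ?Z = qpoch_inf (0 * (z_var * q_var)) q_var"
    by (rule q_binomial[OF _ _ _ _ E]) (use p_rec in simp_all)
  then have EZ: "E * ?Z = 1"
    by (simp add: qpoch_inf_zero)

  define B where "B = Abs_fps (\<lambda>N. \<Sum>n\<le>N. fps_nth (gf_no_ones n) N)"
  have B: "gf_no_ones sums B"
    by (rule fps_sumsI) (simp_all add: B_def gf_no_ones_def fps_nth_const_X_power_mult)
  define A where "A = Abs_fps (\<lambda>N. \<Sum>n\<le>N. fps_nth (gf_ones n) N)"
  have A: "gf_ones sums A"
    by (rule fps_sumsI) (simp_all add: A_def gf_ones_def fps_nth_const_X_power_mult)
  have AB: "crank_gf = A + B"
    by (rule sums_unique2[OF crank_gf_sums sums_add[OF A B]])

  \<comment> \<open>The factor 1 - q cancels the part 1 in \<open>?p 1 n\<close> for n > 0, and from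
    n = 2 on the terms are those of \<open>gf_no_ones\<close>. The terms n = 0 and n = 1 are 1 - q
    and zq: here the anomalous 1 + (z - 1) q arises.\<close>
  have "E * (1 - q_var) = B + ((1 - q_var) + z_var * q_var)"
  proof (rule sums_unique2[OF fps_sums_mult_right[OF E]])
    let ?c = "\<lambda>n. if n = 0 then 1 - q_var else z_var * q_var"
    have "(\<lambda>n. if n \<in> {..1} then ?c n else 0) sums (\<Sum>n\<in>{..1::nat}. ?c n)"
      by (rule sums_If_finite_set) simp
    from sums_add[OF B this]
    have "(\<lambda>n. gf_no_ones n + (if n \<le> 1 then ?c n else 0)) sums (B + ((1 - q_var) + z_var * q_var))"
      by simp
    also have "(\<lambda>n. gf_no_ones n + (if n \<le> 1 then ?c n else 0)) =
        (\<lambda>n. ?p 1 n * (z_var * q_var) ^ n * (1 - q_var))"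
    proof
      fix n
      show "gf_no_ones n + (if n \<le> 1 then ?c n else 0) = ?p 1 n * (z_var * q_var) ^ n * (1 - q_var)"
      proof (cases "n = 0")
        case False
        then have "1 \<le> n"
          by simp
        from p_1[OF this]
        have "?p 1 n * (z_var * q_var) ^ n * (1 - q_var) = fps_const (zpow (int n)) * q_var ^ n * ?p 2 n"
          by (simp add: power_mult_distrib fps_const_power zpow_power mult_ac)
        also have "\<dots> = gf_no_ones n + (if n \<le> 1 then ?c n else 0)"
          using False by (cases "n = 1") (simp_all add: gf_no_ones_def)
        finally show ?thesis ..
      qed (simp add: gf_no_ones_def)
    qed
    finally show "(\<lambda>n. ?p 1 n * (z_var * q_var) ^ n * (1 - q_var)) sums (B + ((1 - q_var) + z_var * q_var))" .
  qed
  then have ag: "1 + (z_var - 1) * q_var + crank_gf = E * (1 - q_var) + A"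
    by (simp add: AB algebra_simps)

  \<comment> \<open>This is (zq;q)_n/(q;q)_n. The q-binomial theorem applies with a = zq and t =
    q/z, whence a t = q^2.\<close>
  define c where "c n = (\<Prod>k<n. 1 - z_var * q_var * q_var ^ k) * ?p 1 n" for n
  define F where "F = Abs_fps (\<lambda>N. \<Sum>n\<le>N. fps_nth (c n * (z_inv * q_var) ^ n) N)"
  have F: "(\<lambda>n. c n * (z_inv * q_var) ^ n) sums F"
    by (rule fps_sumsI)
      (simp_all add: F_def power_mult_distrib fps_X_power_mult_right_nth flip: mult.assoc)
  have c_rec: "c (Suc n) * (1 - q_var ^ Suc n) = c n * (1 - z_var * q_var * q_var ^ n)" for n
    unfolding c_def p_rec[of n, symmetric] by (simp add: mult_ac)
  have "F * ?W = qpoch_inf (z_var * q_var * (z_inv * q_var)) q_var"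
    by (rule q_binomial[OF _ _ _ c_rec F]) (simp_all add: c_def)
  also have "z_var * q_var * (z_inv * q_var) = (z_var * z_inv) * (q_var * q_var)"
    by (simp only: mult_ac)
  finally have FW: "F * ?W = qpoch_inf (q_var * q_var) q_var"
    by (simp only: z_mult_z_inv mult_1_left)

  \<comment> \<open>The series agree term by term except at n = 0, where \<open>gf_ones\<close> is 0
    and \<open>F * (1 - q_var)\<close> has the term 1 - q. The same 1 - q is the value of
    \<open>E * (1 - q_var) * ?Z\<close>.\<close>
  have "A * ?Z + (1 - q_var) = F * (1 - q_var)"
  proof (rule sums_unique2[OF sums_add[OF fps_sums_mult_right[OF A] sums_single[where i = 0 and f = "\<lambda>_. 1 - q_var"]]])
    have "c n * (z_inv * q_var) ^ n * (1 - q_var) = gf_ones n * ?Z + (if n = 0 then 1 - q_var else 0)" for n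
    proof (cases "n = 0")
      case False
      then have "c n * (z_inv * q_var) ^ n * (1 - q_var) =
          (\<Prod>k<n. 1 - z_var * q_var * q_var ^ k) * (z_inv * q_var) ^ n * (?p 1 n * (1 - q_var))"
        by (simp only: c_def mult_ac)
      also have "\<dots> = fps_const (zpow (- int n)) * q_var ^ n *
          ((\<Prod>k<n. 1 - z_var * q_var * q_var ^ k) * ?p 2 n)"
        using False by (subst p_1) (simp_all add: power_mult_distrib fps_const_power zpow_power mult_ac)
      also have "\<dots> = gf_ones n * ?Z"
        using False by (intro gf_ones_mult_qpoch[symmetric]) simp
      finally show ?thesis
        using False by simp
    qed (simp add: gf_ones_def c_def)
    with fps_sums_mult_right[OF F, of "1 - q_var"]
    show "(\<lambda>n. gf_ones n * ?Z + (if n = 0 then 1 - q_var else 0)) sums (F * (1 - q_var))"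
      by simp
  qed
  moreover have "(E * (1 - q_var) + A) * ?Z = A * ?Z + (1 - q_var)"
    using EZ by (simp add: algebra_simps flip: mult.assoc)
  ultimately have "(E * (1 - q_var) + A) * ?Z * ?W = (1 - q_var) * (F * ?W)"
    by (simp add: mult_ac)
  also have "\<dots> = qpoch_inf q_var q_var"
    unfolding FW by (rule qpoch_inf_rec[symmetric]) simp_all
  finally show ?thesis
    unfolding ag .
qed


section \<open>The M2-crank\<close>

text \<open>The crank identity is taken at q^2 and multiplied by (-q;q^2)_inf.
  \<open>M2_denom\<close> cancels: it has constant coefficient 1, and the power series form an
  integral domain.\<close>

lemma M2_gf_eq:
  "M2_gf = qpoch_inf (- q_var) (q_var ^ 2) *
    (1 + (z_var - 1) * q_var ^ 2 + (crank_gf oo q_var ^ 2))"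
proof -
  let ?X2 = "q_var ^ 2" and ?D = "qpoch_inf (- q_var) (q_var ^ 2)"
  have X2: "fps_nth ?X2 0 = 0"
    by simp
  note dist = fps_compose_mult_distrib[OF X2]
  have "(1 + (z_var - 1) * q_var + crank_gf) oo ?X2 = 1 + (z_var - 1) * ?X2 + (crank_gf oo ?X2)"
    by (simp add: fps_compose_add_distrib fps_compose_sub_distrib dist)
  moreover have "(qpoch_inf (z_var * q_var) q_var * qpoch_inf (z_inv * q_var) q_var) oo ?X2 = M2_denom"
    by (simp add: dist qpoch_inf_compose M2_denom_def)
  moreover have "qpoch_inf q_var q_var oo ?X2 = qpoch_inf ?X2 ?X2"
    by (simp add: qpoch_inf_compose)
  ultimately have "(1 + (z_var - 1) * ?X2 + (crank_gf oo ?X2)) * M2_denom = qpoch_inf ?X2 ?X2"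
    using arg_cong[OF crank_gf_product, of "\<lambda>f. f oo ?X2"] by (simp add: dist mult.assoc)
  then have "?D * (1 + (z_var - 1) * ?X2 + (crank_gf oo ?X2)) * M2_denom = M2_gf * M2_denom"
    by (simp add: M2_gf_mult_denom mult.assoc)
  moreover have "M2_denom \<noteq> 0"
  proof
    assume "M2_denom = 0"
    then have "fps_nth M2_denom 0 = 0" by simp
    then show False
      by (simp add: M2_denom_def has_prod_qpoch_inf(2))
  qed
  ultimately show ?thesis
    by simp
qed

lemma POD_eq: "{\<pi> \<in> POD. sum_mset \<pi> = n} = distinct_partitions_in {k. odd k} n"
  by (auto simp: POD_def distinct_partitions_in_def partitions_in_def)

text \<open>For even \<open>n\<close>, halving the parts is a bijection onto the non-empty
  partitions of \<open>n div 2\<close>. For odd \<open>n\<close> both sides vanish.\<close>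

lemma sum_PE_crank:
  "(\<Sum>\<pi> | \<pi> \<in> PE \<and> sum_mset \<pi> = n \<and> \<pi> \<noteq> {#}. zpow (crank (half_partition \<pi>)))
    = fps_nth (crank_gf oo q_var ^ 2) n"
proof (cases "even n")
  case True
  have half: "half_partition (image_mset ((*) 2) \<sigma>) = \<sigma>" for \<sigma>
    by (simp add: half_partition_def multiset.map_comp comp_def)
  have double: "image_mset ((*) 2) (half_partition \<pi>) = \<pi>" if "\<pi> \<in> PE" for \<pi>
  proof -
    have "image_mset (\<lambda>k. 2 * (k div 2)) \<pi> = image_mset (\<lambda>k. k) \<pi>"
      using that by (intro image_mset_cong) (auto simp: PE_def)
    then show ?thesis
      by (simp add: half_partition_def multiset.map_comp comp_def)
  qed
  have sum: "sum_mset (image_mset ((*) 2) \<sigma>) = 2 * sum_mset \<sigma>" for \<sigma> :: "nat multiset"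
    by (induction \<sigma>) auto
  have "(\<Sum>\<pi> | \<pi> \<in> PE \<and> sum_mset \<pi> = n \<and> \<pi> \<noteq> {#}. zpow (crank (half_partition \<pi>))) =
      (\<Sum>\<sigma>\<in>partitions_in {1..} (n div 2) - {{#}}. zpow (crank \<sigma>))"
  proof (rule sum.reindex_bij_witness[where i = "image_mset ((*) 2)" and j = half_partition])
    fix \<pi> assume \<pi>: "\<pi> \<in> {\<pi>. \<pi> \<in> PE \<and> sum_mset \<pi> = n \<and> \<pi> \<noteq> {#}}"
    then show "image_mset ((*) 2) (half_partition \<pi>) = \<pi>"
      by (simp add: double)
    have "2 * sum_mset (half_partition \<pi>) = n"
      using \<pi> double[of \<pi>] sum[of "half_partition \<pi>"] by simp
    moreover have "1 \<le> k div 2" if "k \<in># \<pi>" for k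
    proof -
      have "even k" "0 < k"
        using \<pi> that by (auto simp: PE_def)
      then show ?thesis
        by presburger
    qed
    then have "set_mset (half_partition \<pi>) \<subseteq> {1..}"
      by (auto simp: half_partition_def)
    ultimately show "half_partition \<pi> \<in> partitions_in {1..} (n div 2) - {{#}}"
      using \<pi> by (auto simp: partitions_in_def half_partition_def)
  next
    fix \<sigma> assume \<sigma>: "\<sigma> \<in> partitions_in {1..} (n div 2) - {{#}}"
    show "half_partition (image_mset ((*) 2) \<sigma>) = \<sigma>"
      by (rule half)
    show "image_mset ((*) 2) \<sigma> \<in> {\<pi>. \<pi> \<in> PE \<and> sum_mset \<pi> = n \<and> \<pi> \<noteq> {#}}"
      using \<sigma> True by (auto simp: PE_def partitions_in_def sum)
  qed simp
  then show ?thesis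
    using True by (simp add: fps_compose_X_square_nth crank_gf_def)
next
  case False
  have "even (sum_mset \<pi>)" if "\<forall>k\<in>#\<pi>. even k" for \<pi> :: "nat multiset"
    using that by (induction \<pi>) auto
  then have "{\<pi>. \<pi> \<in> PE \<and> sum_mset \<pi> = n \<and> \<pi> \<noteq> {#}} = {}"
    using False by (auto simp: PE_def)
  then have "(\<Sum>\<pi> | \<pi> \<in> PE \<and> sum_mset \<pi> = n \<and> \<pi> \<noteq> {#}. zpow (crank (half_partition \<pi>))) = 0"
    by (simp only: sum.empty)
  then show ?thesis
    using False by (simp add: fps_compose_X_square_nth)
qed

section \<open>Distinct odd parts and the anomalous term\<close>

lemma POD_add_mset:
  "add_mset M \<tau> \<in> POD \<longleftrightarrow> odd M \<and> M \<notin># \<tau> \<and> \<tau> \<in> POD"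
proof -
  have "(\<forall>k. count (add_mset M \<tau>) k \<le> 1) \<longleftrightarrow> M \<notin># \<tau> \<and> (\<forall>k. count \<tau> k \<le> 1)"
    by (auto simp: not_in_iff le_Suc_eq split: if_splits)
  then show ?thesis
    by (auto simp: POD_def)
qed

lemma largest_part_add_mset:
  assumes "\<forall>k\<in>#\<tau>. k < M"
  shows "largest_part (add_mset M \<tau>) = M"
  using assms unfolding largest_part_def by (intro Max_eqI) auto

lemma POD_cases:
  assumes "\<pi> \<in> POD" "\<pi> \<noteq> {#}"
  obtains M \<tau> where "\<pi> = add_mset M \<tau>" "\<forall>k\<in>#\<tau>. k < M" "odd M" "\<tau> \<in> POD"
proof -
  have "largest_part \<pi> \<in># \<pi>"
    unfolding largest_part_def using assms by (intro Max_in) auto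
  then obtain \<tau> where \<tau>: "\<pi> = add_mset (largest_part \<pi>) \<tau>"
    by (meson multi_member_split)
  with assms have P: "odd (largest_part \<pi>)" "largest_part \<pi> \<notin># \<tau>" "\<tau> \<in> POD"
    using POD_add_mset[of "largest_part \<pi>" \<tau>] by simp_all
  have "k < largest_part \<pi>" if "k \<in># \<tau>" for k
  proof -
    have "k \<in># \<pi>"
      by (subst \<tau>) (simp add: that)
    then have "k \<le> largest_part \<pi>"
      unfolding largest_part_def by simp
    with that P(2) show ?thesis
      by (metis le_neq_implies_less)
  qed
  with \<tau> P that show ?thesis
    by blast
qed

text \<open>The cases of \<open>theta\<close> merge: for M = 3 the part asked for is M - 2 = 1, and
  for M = 1 the part 1 is present. For \<tau> in \<open>POD\<close>, the value is 1 exactly when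
  lowering \<open>M\<close> by 2 gives another partition into distinct odd parts.\<close>

lemma theta_add_mset:
  assumes "odd M" "\<forall>k\<in>#\<tau>. k < M"
  shows "theta (add_mset M \<tau>) = (if 3 \<le> M \<and> M - 2 \<notin># \<tau> then 1 else 0)"
proof -
  have "M = 1 \<or> M = 3 \<or> 5 \<le> M"
    using assms(1) by presburger
  then show ?thesis
    using largest_part_add_mset[OF assms(2)] by (auto simp: theta_def)
qed

text \<open>Adding 2 to the largest part; the empty partition has no largest part, whence \<^term>\<open>n \<noteq> 2\<close>.\<close>

lemma card_theta_1:
  assumes "2 < n"
  shows "card {\<pi> \<in> POD. sum_mset \<pi> = n \<and> theta \<pi> = 1} = card {\<pi> \<in> POD. sum_mset \<pi> = n - 2}"
proof -
  let ?S = "{\<pi> \<in> POD. sum_mset \<pi> = n \<and> theta \<pi> = 1}" and ?T = "{\<pi> \<in> POD. sum_mset \<pi> = n - 2}"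
  let ?up = "\<lambda>\<pi>. add_mset (largest_part \<pi> + 2) (\<pi> - {#largest_part \<pi>#})"
  let ?down = "\<lambda>\<pi>. add_mset (largest_part \<pi> - 2) (\<pi> - {#largest_part \<pi>#})"
  have *: "?down \<pi> \<in> POD \<and> sum_mset (?down \<pi>) = n - 2 \<and> ?up (?down \<pi>) = \<pi>"
    if "\<pi> \<in> POD" "sum_mset \<pi> = n" "theta \<pi> = 1" for \<pi>
  proof -
    have "\<pi> \<noteq> {#}"
      using that assms by auto
    with that(1) obtain M \<tau> where \<pi>: "\<pi> = add_mset M \<tau>" "\<forall>k\<in>#\<tau>. k < M" "odd M" "\<tau> \<in> POD"
      by (rule POD_cases)
    have M: "3 \<le> M" "M - 2 \<notin># \<tau>"
      using that(3) \<pi> by (auto simp: theta_add_mset split: if_splits)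
    \<comment> \<open>By parity, M - 2 is the only odd number below \<open>M\<close> that is not
      below M - 2. So the lowered part is still the largest and can be raised back.\<close>
    have "\<forall>k\<in>#\<tau>. k < M - 2"
    proof
      fix k assume k: "k \<in># \<tau>"
      then have "k < M" "odd k" "k \<noteq> M - 2"
        using \<pi> M by (auto simp: POD_def)
      with \<open>odd M\<close> show "k < M - 2"
        by presburger
    qed
    from largest_part_add_mset[OF this] largest_part_add_mset[OF \<pi>(2)] show ?thesis
      using \<pi> M that by (auto simp: POD_add_mset)
  qed
  have **: "?up \<sigma> \<in> POD \<and> sum_mset (?up \<sigma>) = n \<and> theta (?up \<sigma>) = 1 \<and> ?down (?up \<sigma>) = \<sigma>"
    if "\<sigma> \<in> POD" "sum_mset \<sigma> = n - 2" for \<sigma>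
  proof -
    have "\<sigma> \<noteq> {#}"
      using that assms by auto
    with that(1) obtain M \<tau> where \<sigma>: "\<sigma> = add_mset M \<tau>" "\<forall>k\<in>#\<tau>. k < M" "odd M" "\<tau> \<in> POD"
      by (rule POD_cases)
    have lt: "\<forall>k\<in>#\<tau>. k < M + 2"
      using \<sigma>(2) by auto
    have "M + 2 \<notin># \<tau>" "M \<notin># \<tau>" "0 < M"
      using \<sigma>(2,3) lt by (auto intro: odd_pos)
    with largest_part_add_mset[OF lt] largest_part_add_mset[OF \<sigma>(2)] theta_add_mset[OF _ lt] show ?thesis
      using \<sigma> that assms by (auto simp: POD_add_mset)
  qed
  have "bij_betw ?down ?S ?T"
  proof (rule bij_betw_byWitness[where f' = ?up])
    show "\<forall>\<pi>\<in>?S. ?up (?down \<pi>) = \<pi>" "?down ` ?S \<subseteq> ?T"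
      using * by blast+
    show "\<forall>\<sigma>\<in>?T. ?down (?up \<sigma>) = \<sigma>" "?up ` ?T \<subseteq> ?S"
      using ** by blast+
  qed
  then show ?thesis
    by (rule bij_betw_same_card)
qed

lemma finite_POD: "finite {\<pi> \<in> POD. sum_mset \<pi> = n}"
  unfolding POD_eq by (rule finite_distinct_partitions_in) simp

lemma finite_PE: "finite {\<pi>. \<pi> \<in> PE \<and> sum_mset \<pi> = n \<and> \<pi> \<noteq> {#}}"
  by (rule finite_subset[OF _ finite_partitions_in[of "{1..}" n]])
    (auto simp: PE_def partitions_in_def Suc_le_eq)

lemma qpoch_inf_odd_nth:
  "fps_nth (qpoch_inf (- q_var) (q_var ^ 2)) n = of_nat (card {\<pi> \<in> POD. sum_mset \<pi> = n})"
  by (simp add: POD_eq distinct_partition_gf_def flip: distinct_odd_partition_gf)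

text \<open>The right side counts partitions of \<open>n\<close>, plus z - 1 times those of n - 2,
  which match the partitions with \<open>theta\<close> equal to 1. At n = 2 it would count the empty
  partition, which comes from no partition of 2.\<close>

lemma sum_theta:
  assumes "n \<noteq> 2"
  shows "(\<Sum>\<pi> | \<pi> \<in> POD \<and> sum_mset \<pi> = n. zpow (theta \<pi>)) =
    fps_nth (qpoch_inf (- q_var) (q_var ^ 2) * (1 + (z_var - 1) * q_var ^ 2)) n"
proof -
  let ?P = "\<lambda>n. {\<pi> \<in> POD. sum_mset \<pi> = n}"
  \<comment> \<open>\<open>theta\<close> takes only the values 0 and 1, so z^theta is affine in the
    indicator of the value 1.\<close>
  have theta: "zpow (theta \<pi>) = 1 + (if theta \<pi> = 1 then zpow 1 - 1 else 0)" for \<pi>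
    by (auto simp: theta_def)
  have "card {\<pi> \<in> ?P n. theta \<pi> = 1} = (if n < 2 then 0 else card (?P (n - 2)))"
  proof (cases "n < 2")
    case True
    have "theta \<pi> \<noteq> 1" if \<pi>: "\<pi> \<in> ?P n" for \<pi>
    proof (cases "\<pi> = {#}")
      case False
      with \<pi> obtain M \<tau> where "\<pi> = add_mset M \<tau>" "\<forall>k\<in>#\<tau>. k < M" "odd M"
        using POD_cases[of \<pi>] by blast
      moreover from this \<pi> True have "M < 3"
        by simp
      ultimately show ?thesis
        by (simp add: theta_add_mset)
    qed (simp add: theta_def)
    then have "{\<pi> \<in> ?P n. theta \<pi> = 1} = {}"
      by blast
    then show ?thesis
      by (simp only: card.empty if_P[OF True])
  next
    case False
    with assms card_theta_1[of n] show ?thesis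
      by (simp add: conj_assoc)
  qed
  moreover have "(\<Sum>\<pi>\<in>?P n. zpow (theta \<pi>)) =
      of_nat (card (?P n)) + of_nat (card {\<pi> \<in> ?P n. theta \<pi> = 1}) * (zpow 1 - 1)"
    unfolding theta by (simp add: sum.distrib sum.If_cases finite_POD Int_def conj_assoc)
  moreover have "fps_nth (D * (1 + (z_var - 1) * q_var ^ 2)) n =
      fps_nth D n + (if n < 2 then 0 else fps_nth D (n - 2) * (zpow 1 - 1))" for D :: "laurent fps"
  proof -
    have "D * (1 + (z_var - 1) * q_var ^ 2) = D + D * fps_const (zpow 1 - 1) * q_var ^ 2"
      by (simp add: algebra_simps flip: fps_const_sub)
    then show ?thesis
      by (simp add: fps_X_power_mult_right_nth)
  qed
  ultimately show ?thesis
    by (simp add: qpoch_inf_odd_nth)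
qed

section \<open>Combination of the odd and the even parts\<close>

text \<open>The Cauchy product groups pairs by the size of the odd component. The weight depends on
  the even component alone, so the first factor only counts.\<close>

lemma sum_crank_pairs:
  "(\<Sum>(\<pi>1, \<pi>2) | \<pi>1 \<in> POD \<and> \<pi>2 \<in> PE \<and> \<pi>2 \<noteq> {#} \<and> sum_mset \<pi>1 + sum_mset \<pi>2 = n.
      zpow (crank (half_partition \<pi>2))) =
    fps_nth (qpoch_inf (- q_var) (q_var ^ 2) * (crank_gf oo q_var ^ 2)) n"
proof -
  let ?P = "\<lambda>n. {\<pi> \<in> POD. sum_mset \<pi> = n}"
  let ?Q = "\<lambda>n. {\<pi>. \<pi> \<in> PE \<and> sum_mset \<pi> = n \<and> \<pi> \<noteq> {#}}"
  have "fps_nth (qpoch_inf (- q_var) (q_var ^ 2) * (crank_gf oo q_var ^ 2)) n =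
      (\<Sum>i\<in>{0..n}. \<Sum>(\<pi>1, \<pi>2)\<in>?P i \<times> ?Q (n - i). zpow (crank (half_partition \<pi>2)))"
    unfolding fps_mult_nth qpoch_inf_odd_nth sum_PE_crank[symmetric] sum.cartesian_product[symmetric]
    by simp
  also have "\<dots> = (\<Sum>(i, \<pi>1, \<pi>2)\<in>(SIGMA i:{0..n}. ?P i \<times> ?Q (n - i)). zpow (crank (half_partition \<pi>2)))"
    using finite_POD finite_PE by (subst sum.Sigma) auto
  also have "\<dots> = (\<Sum>(\<pi>1, \<pi>2) | \<pi>1 \<in> POD \<and> \<pi>2 \<in> PE \<and> \<pi>2 \<noteq> {#} \<and> sum_mset \<pi>1 + sum_mset \<pi>2 = n.
      zpow (crank (half_partition \<pi>2)))"
    by (rule sum.reindex_bij_witness[where i = "\<lambda>(\<pi>1, \<pi>2). (sum_mset \<pi>1, \<pi>1, \<pi>2)" and j = snd]) auto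
  finally show ?thesis ..
qed

theorem theorem4p1:
  fixes n :: nat and m :: int
  assumes "n \<noteq> 2"
  shows "int (card {\<pi> \<in> parts_no_rep_odd n. M2crank \<pi> = m}) = M2 m n"
proof -
  let ?P = "{\<pi> \<in> POD. sum_mset \<pi> = n}"
  let ?R = "{(\<pi>1, \<pi>2). \<pi>1 \<in> POD \<and> \<pi>2 \<in> PE \<and> \<pi>2 \<noteq> {#} \<and> sum_mset \<pi>1 + sum_mset \<pi>2 = n}"
  \<comment> \<open>Pairs with empty even component carry \<open>theta\<close> and account for the
    anomalous term of \<open>M2_gf_eq\<close>; the others account for the crank series.\<close>
  have parts: "parts_no_rep_odd n = (\<lambda>\<pi>. (\<pi>, {#})) ` ?P \<union> ?R"
    by (auto simp: parts_no_rep_odd_def PE_def)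
  have finR: "finite ?R"
  proof (rule finite_subset)
    show "?R \<subseteq> (\<Union>i\<in>{..n}. \<Union>j\<in>{..n}.
        {\<pi> \<in> POD. sum_mset \<pi> = i} \<times> {\<pi>. \<pi> \<in> PE \<and> sum_mset \<pi> = j \<and> \<pi> \<noteq> {#}})"
      by auto
  qed (auto simp: finite_POD finite_PE)
  have "(\<Sum>\<pi>\<in>parts_no_rep_odd n. zpow (M2crank \<pi>)) =
      (\<Sum>\<pi>\<in>(\<lambda>\<pi>. (\<pi>, {#})) ` ?P. zpow (M2crank \<pi>)) + (\<Sum>\<pi>\<in>?R. zpow (M2crank \<pi>))"
    unfolding parts using finR finite_POD by (intro sum.union_disjoint) auto
  also have "(\<Sum>\<pi>\<in>(\<lambda>\<pi>. (\<pi>, {#})) ` ?P. zpow (M2crank \<pi>)) = (\<Sum>\<pi>\<in>?P. zpow (theta \<pi>))"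
    by (subst sum.reindex) (auto intro: inj_onI)
  also have "(\<Sum>\<pi>\<in>?R. zpow (M2crank \<pi>)) = (\<Sum>(\<pi>1, \<pi>2)\<in>?R. zpow (crank (half_partition \<pi>2)))"
    by (intro sum.cong) auto
  finally have "(\<Sum>\<pi>\<in>parts_no_rep_odd n. zpow (M2crank \<pi>)) = fps_nth M2_gf n"
    unfolding sum_theta[OF assms] sum_crank_pairs M2_gf_eq by (simp add: distrib_left)
  then have "M2 m n = Poly_Mapping.lookup (\<Sum>\<pi>\<in>parts_no_rep_odd n. zpow (M2crank \<pi>)) m"
    by (simp only: M2_def)
  also have "\<dots> = (\<Sum>\<pi>\<in>parts_no_rep_odd n. if M2crank \<pi> = m then 1 else 0)"
    by (simp add: Poly_Mapping.lookup_sum lookup_single when_def eq_commute[of m])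
  also have "\<dots> = int (card {\<pi> \<in> parts_no_rep_odd n. M2crank \<pi> = m})"
    using finR finite_POD by (simp add: parts sum.If_cases Int_def)
  finally show ?thesis ..
qed

end
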